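(* Let $A$ be a positive semi-definite $(l+d)\times(l+d)$ symmetrizable intersection matrix with $\operatorname{rank}A=l$. Then $A$ is braid-equivalent to a $d$-fold affinization matrix $C^{[d]}$ (of some $l\times l$ Cartan matrix $C$).
   Context: A generalized intersection matrix is an integral matrix $A=(A_{ij})_{i,j\in I}$, $I$ finite, with $A_{ii}=2$, $A_{ij}<0\Leftrightarrow A_{ji}<0$ and $A_{ij}>0\Leftrightarrow A_{ji}>0$. It is a symmetrizable intersection matrix (SIM) if there is $D=\mathrm{diag}(d_i)_{i\in I}$ with positive integers $d_i$, $\gcd(d_i)=1$, such that $B=DA$ is symmetric; $A$ is positive semi-definite if $DA$ is. The SIM-root basis of $A$ is a basis $\Delta=\{\alpha_i\mid i\in I\}$ of a $\mathbb Q$-vector space $H$ of dimension $|I|$ with symmetric bilinear form $(\alpha_i,\alpha_j)=B_{ij}$, so $A_{ij}=2(\alpha_i,\alpha_j)/(\alpha_i,\alpha_i)$; $A$ is the structural matrix of $\Delta$. Put $s_\alpha(\beta)=\beta-\frac{2(\alpha,\beta)}{(\alpha,\alpha)}\alpha$. For $a,b\in I$ the braid-transformation $\tau_{a,b}$ replaces $\Delta$ by $\Delta'=\{\alpha'_i\}$ with $\alpha'_i=\alpha_i$ for $i\ne b$ and $\alpha'_b=s_{\alpha_a}(\alpha_b)$; $\tau_{a,b}A$ is the structural matrix of $\Delta'$. Two SIMs are braid-equivalent if one is obtained from the other by a finite sequence of braid-transformations and permutations of the index set. A Cartan matrix is a positive definite symmetrizable generalized Cartan matrix (not necessarily indecomposable).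 Let $C$ be an $l\times l$ Cartan matrix with root system $\dot R$, simple roots $\dot\Delta=\{\alpha_1,\dots,\alpha_l\}$ and induced form $(-,-)_C$ with $C_{ij}=2(\alpha_i,\alpha_j)_C/(\alpha_i,\alpha_i)_C$. A $d$-fold affinization of $C$ is an $(l+d)\times(l+d)$ matrix $C^{[d]}$ with $C^{[d]}_{ij}=\frac{2(\alpha_i,\alpha_j)_C}{(\alpha_i,\alpha_i)_C}$ for $1\le i,j\le l+d$, where $\alpha_{l+1},\dots,\alpha_{l+d}\in\dot R\cup2\dot R$ ($2\dot R=\{2\alpha\mid\alpha\in\dot R\}$) are such that all $C^{[d]}_{ij}$ are integers. *)

theory Defs
  imports "Jordan_Normal_Form.DL_Rank" "HOL-Combinatorics.Permutations"
begin

text \<open>Integral matrices are rational matrices with entries in \<open>\<int>\<close>; the index set is \<open>{..<n}\<close>.\<close>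

definition gen_intersection_matrix :: "nat \<Rightarrow> rat mat \<Rightarrow> bool" where
  "gen_intersection_matrix n A \<longleftrightarrow>
     A \<in> carrier_mat n n \<and>
     (\<forall>i<n. \<forall>j<n. A $$ (i,j) \<in> \<int>) \<and>
     (\<forall>i<n. A $$ (i,i) = 2) \<and>
     (\<forall>i<n. \<forall>j<n. A $$ (i,j) < 0 \<longleftrightarrow> A $$ (j,i) < 0) \<and>
     (\<forall>i<n. \<forall>j<n. A $$ (i,j) > 0 \<longleftrightarrow> A $$ (j,i) > 0)"

definition gen_cartan_matrix :: "nat \<Rightarrow> rat mat \<Rightarrow> bool" where
  "gen_cartan_matrix n C \<longleftrightarrow>
     C \<in> carrier_mat n n \<and>
     (\<forall>i<n. \<forall>j<n. C $$ (i,j) \<in> \<int>) \<and>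
     (\<forall>i<n. C $$ (i,i) = 2) \<and>
     (\<forall>i<n. \<forall>j<n. i \<noteq> j \<longrightarrow> C $$ (i,j) \<le> 0) \<and>
     (\<forall>i<n. \<forall>j<n. C $$ (i,j) = 0 \<longleftrightarrow> C $$ (j,i) = 0)"

definition symmetrized :: "nat \<Rightarrow> (nat \<Rightarrow> nat) \<Rightarrow> rat mat \<Rightarrow> rat mat" where
  "symmetrized n d A = mat_diag n (\<lambda>i. of_nat (d i)) * A"

definition symmetrizer :: "nat \<Rightarrow> (nat \<Rightarrow> nat) \<Rightarrow> rat mat \<Rightarrow> bool" where
  "symmetrizer n d A \<longleftrightarrow>
     (\<forall>i<n. d i > 0) \<and> Gcd (d ` {..<n}) = 1 \<and>
     transpose_mat (symmetrized n d A) = symmetrized n d A"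

definition SIM :: "nat \<Rightarrow> rat mat \<Rightarrow> bool" where
  "SIM n A \<longleftrightarrow> gen_intersection_matrix n A \<and> (\<exists>d. symmetrizer n d A)"

text \<open>For decomposable \<open>A\<close> the symmetrizer is not unique, but any two differ by a positive
  factor on each indecomposable block, so nothing below depends on which one is taken.
  Definiteness of a symmetric rational matrix is tested on real vectors.\<close>

definition pos_semidef :: "nat \<Rightarrow> rat mat \<Rightarrow> bool" where
  "pos_semidef n A \<longleftrightarrow>
     (\<exists>d. symmetrizer n d A \<and>
       (\<forall>v \<in> carrier_vec n. v \<bullet> (map_mat real_of_rat (symmetrized n d A) *\<^sub>v v) \<ge> 0))"

definition pos_def :: "nat \<Rightarrow> rat mat \<Rightarrow> bool" where
  "pos_def n A \<longleftrightarrow>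
     (\<exists>d. symmetrizer n d A \<and>
       (\<forall>v \<in> carrier_vec n. v \<noteq> 0\<^sub>v n \<longrightarrow>
          v \<bullet> (map_mat real_of_rat (symmetrized n d A) *\<^sub>v v) > 0))"

definition cartan_matrix :: "nat \<Rightarrow> rat mat \<Rightarrow> bool" where
  "cartan_matrix n C \<longleftrightarrow>
     gen_cartan_matrix n C \<and> (\<exists>d. symmetrizer n d C) \<and> pos_def n C"

text \<open>The space \<open>H\<close> is \<open>carrier_vec n\<close> over the rationals, written in coordinates with respect
  to the SIM-root basis: \<open>\<alpha>\<^sub>i\<close> is \<open>unit_vec n i\<close>, and the form has Gram matrix \<open>B = DA\<close>.\<close>

definition form :: "rat mat \<Rightarrow> rat vec \<Rightarrow> rat vec \<Rightarrow> rat" where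
  "form B v w = v \<bullet> (B *\<^sub>v w)"

definition reflection :: "rat mat \<Rightarrow> rat vec \<Rightarrow> rat vec \<Rightarrow> rat vec" where
  "reflection B \<alpha> \<beta> = \<beta> - (2 * form B \<alpha> \<beta> / form B \<alpha> \<alpha>) \<cdot>\<^sub>v \<alpha>"

definition structural_mat :: "nat \<Rightarrow> rat mat \<Rightarrow> (nat \<Rightarrow> rat vec) \<Rightarrow> rat mat" where
  "structural_mat n B \<Delta> =
     mat n n (\<lambda>(i,j). 2 * form B (\<Delta> i) (\<Delta> j) / form B (\<Delta> i) (\<Delta> i))"

definition braid_basis ::
  "rat mat \<Rightarrow> nat \<Rightarrow> nat \<Rightarrow> (nat \<Rightarrow> rat vec) \<Rightarrow> nat \<Rightarrow> rat vec" where
  "braid_basis B a b \<Delta> = \<Delta>(b := reflection B (\<Delta> a) (\<Delta> b))"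

definition braid_step :: "nat \<Rightarrow> rat mat \<Rightarrow> rat mat \<Rightarrow> bool" where
  "braid_step n A A' \<longleftrightarrow>
     (\<exists>d a b. symmetrizer n d A \<and> a < n \<and> b < n \<and>
        A' = structural_mat n (symmetrized n d A)
               (braid_basis (symmetrized n d A) a b (unit_vec n)))"

definition perm_step :: "nat \<Rightarrow> rat mat \<Rightarrow> rat mat \<Rightarrow> bool" where
  "perm_step n A A' \<longleftrightarrow>
     (\<exists>p. p permutes {..<n} \<and> A' = mat n n (\<lambda>(i,j). A $$ (p i, p j)))"

text \<open>Both kinds of steps are invertible, hence this relation is symmetric.\<close>

definition braid_equivalent :: "nat \<Rightarrow> rat mat \<Rightarrow> rat mat \<Rightarrow> bool" where
  "braid_equivalent n A A' \<longleftrightarrow>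
     SIM n A \<and> SIM n A' \<and> (\<lambda>X Y. braid_step n X Y \<or> perm_step n X Y)\<^sup>*\<^sup>* A A'"

text \<open>The root system of a Cartan matrix with Gram matrix \<open>B\<close>: the orbit of the simple roots
  under the Weyl group, which is generated by the simple reflections.\<close>

inductive_set root_system :: "nat \<Rightarrow> rat mat \<Rightarrow> rat vec set" for l :: nat and B :: "rat mat" where
  simple: "i < l \<Longrightarrow> unit_vec l i \<in> root_system l B"
| reflect: "\<lbrakk>i < l; \<beta> \<in> root_system l B\<rbrakk> \<Longrightarrow> reflection B (unit_vec l i) \<beta> \<in> root_system l B"

definition affinization :: "nat \<Rightarrow> nat \<Rightarrow> rat mat \<Rightarrow> rat mat \<Rightarrow> bool" where
  "affinization l d C X \<longleftrightarrow>
     (\<exists>e \<alpha>. symmetrizer l e C \<and>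
        (\<forall>i<l. \<alpha> i = unit_vec l i) \<and>
        (\<forall>i\<in>{l..<l + d}. \<alpha> i \<in> root_system l (symmetrized l e C) \<union>
            (\<lambda>\<beta>. 2 \<cdot>\<^sub>v \<beta>) ` root_system l (symmetrized l e C)) \<and>
        X = structural_mat (l + d) (symmetrized l e C) \<alpha> \<and>
        (\<forall>i<l + d. \<forall>j<l + d. X $$ (i,j) \<in> \<int>))"

end

theory Submission
  imports Defs
begin

text \<open>
  Let \<open>B = DA\<close>, an integral positive semi-definite form on \<open>\<int>\<^sup>n\<close> with \<open>n = l + d\<close>. A sequence of
  braid-transformations replaces the standard basis by a tuple \<open>\<beta>\<close> of roots that again generates
  \<open>\<int>\<^sup>n\<close>, with the same norms \<open>(\<beta>\<^sub>i,\<beta>\<^sub>i) = 2d\<^sub>i\<close> and with \<open>d\<^sub>i\<close> dividing all \<open>(\<beta>\<^sub>i,\<beta>\<^sub>j)\<close>. The idea is to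
  choose, among all tuples that can be reached, one that lies as close as possible to a fixed
  generic hyperplane, in the way in which a set of reflections is descended to simple ones.

  By the Cauchy-Schwarz inequality a root pairs with the standard basis by bounded numbers, hence
  some \<open>h\<close> is orthogonal to no root (\<open>generic_vector\<close>). Take \<open>\<beta>\<close> with \<open>\<Sum> |(h,\<beta>\<^sub>i)|\<close> minimal. A
  transformation \<open>\<tau>\<^sub>i\<^sub>,\<^sub>i\<close> changes the sign of \<open>\<beta>\<^sub>i\<close>, so that all heights \<open>f\<^sub>i = (h,\<beta>\<^sub>i)\<close> may be taken
  positive. If \<open>(\<beta>\<^sub>a,\<beta>\<^sub>b) > 0\<close>, let \<open>p = (\<beta>\<^sub>a,\<beta>\<^sub>b)/d\<^sub>a\<close> and \<open>q = (\<beta>\<^sub>a,\<beta>\<^sub>b)/d\<^sub>b\<close> be the two Cartan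
  integers. Neither \<open>\<beta>\<^sub>b - p\<beta>\<^sub>a\<close> nor \<open>\<beta>\<^sub>a - q\<beta>\<^sub>b\<close> is lower than the root that it replaces, so
  \<open>2f\<^sub>b \<le> pf\<^sub>a\<close> and \<open>2f\<^sub>a \<le> qf\<^sub>b\<close>, whence \<open>pq \<ge> 4\<close>. This is equality in Cauchy-Schwarz: the two roots
  are proportional modulo the radical, with ratio \<open>1\<close>, \<open>2\<close> or \<open>1/2\<close> (\<open>reachable_reduced\<close>).

  Pick one shortest root from each class of proportional ones, and let \<open>J\<close> be the set of their
  indices. Distinct members of \<open>J\<close> pair non-positively and all heights are positive, which makes
  them linearly independent modulo the radical (\<open>obtuse_independent\<close>). Their structural
  matrix \<open>C\<close> is therefore a Cartan matrix, and every other root equals a simple one or twice a simple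
  one modulo the radical. As the structural matrix does not see the radical, it is the affinization
  matrix once the indices in \<open>J\<close> are moved to the front. Finally the images of the chosen roots
  under \<open>A\<close> are a basis of the column space of \<open>A\<close>, so \<open>J\<close> has \<open>l\<close> elements
  (\<open>rank_eq_card_subsystem\<close>).
\<close>

section \<open>Bilinear forms in coordinates\<close>

text \<open>Vectors are functions of which only the first \<open>n\<close> values count. The ring is left open because
  the descent is an argument over \<open>\<int>\<close>, the matrices are rational, and definiteness is a
  condition on real vectors.\<close>

definition ip :: "nat \<Rightarrow> (nat \<Rightarrow> nat \<Rightarrow> 'a) \<Rightarrow> (nat \<Rightarrow> 'a) \<Rightarrow> (nat \<Rightarrow> 'a) \<Rightarrow> 'a::comm_ring_1" where
  "ip n B x y = (\<Sum>i<n. \<Sum>j<n. x i * B i j * y j)"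

lemma ip_diff_left:
  "ip n B (\<lambda>j. x j - k * y j) z = ip n B x z - k * ip n B y z"
  unfolding ip_def by (simp add: algebra_simps sum_subtractf sum_distrib_left)

lemma ip_diff_right:
  "ip n B z (\<lambda>j. x j - k * y j) = ip n B z x - k * ip n B z y"
  unfolding ip_def by (simp add: algebra_simps sum_subtractf sum_distrib_left)

lemma ip_sum_left:
  "ip n B (\<lambda>j. \<Sum>i\<in>I. c i * x i j) z = (\<Sum>i\<in>I. c i * ip n B (x i) z)"
  by (induction I rule: infinite_finite_induct)
    (simp_all add: ip_def algebra_simps sum.distrib sum_distrib_left)

lemma ip_sum_right:
  "ip n B z (\<lambda>j. \<Sum>i\<in>I. c i * x i j) = (\<Sum>i\<in>I. c i * ip n B z (x i))"
  by (induction I rule: infinite_finite_induct)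
    (simp_all add: ip_def algebra_simps sum.distrib sum_distrib_left)

lemma ip_commute:
  assumes "\<And>i j. i < n \<Longrightarrow> j < n \<Longrightarrow> B i j = B j i"
  shows "ip n B x y = ip n B y x"
proof -
  have "ip n B x y = (\<Sum>j<n. \<Sum>i<n. x i * B i j * y j)"
    unfolding ip_def by (rule sum.swap)
  also have "\<dots> = ip n B y x"
    unfolding ip_def using assms by (auto intro!: sum.cong simp: ac_simps)
  finally show ?thesis .
qed

abbreviation delta :: "nat \<Rightarrow> nat \<Rightarrow> 'a::comm_ring_1" where
  "delta i \<equiv> (\<lambda>j. if j = i then 1 else 0)"

lemma ip_delta_left: "i < n \<Longrightarrow> ip n B (delta i) y = (\<Sum>j<n. B i j * y j)"
  unfolding ip_def by (simp add: if_distrib[of "\<lambda>t. t * _"] sum.delta' cong: if_cong)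
    (subst sum.swap, simp add: sum.delta)

lemma ip_delta: "i < n \<Longrightarrow> j < n \<Longrightarrow> ip n B (delta i) (delta j) = B i j"
  by (simp add: ip_delta_left if_distrib[of "\<lambda>t. _ * t"] cong: if_cong)

lemma ip_of_int:
  "ip n (\<lambda>i j. of_int (B i j)) (\<lambda>i. of_int (x i)) (\<lambda>i. of_int (y i)) = of_int (ip n B x y)"
  unfolding ip_def by simp

lemma ip_scaled_diff:
  assumes sym: "\<And>i j. i < n \<Longrightarrow> j < n \<Longrightarrow> B i j = B j i"
  shows "ip n B (\<lambda>j. s * x j - t * y j) (\<lambda>j. s * x j - t * y j) =
    s\<^sup>2 * ip n B x x - 2 * s * t * ip n B x y + t\<^sup>2 * ip n B y y"
proof -
  have l: "ip n B (\<lambda>j. s * x j) z = s * ip n B x z" for z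
    unfolding ip_def by (simp add: sum_distrib_left mult.assoc)
  have r: "ip n B z (\<lambda>j. s * x j) = s * ip n B z x" for z
    unfolding ip_def by (simp add: sum_distrib_left ac_simps)
  have c: "ip n B y x = ip n B x y" by (rule ip_commute[OF sym])
  show ?thesis
    by (simp add: ip_diff_left ip_diff_right l r c power2_eq_square algebra_simps)
qed

text \<open>If \<open>(z,x) \<noteq> 0\<close> for an isotropic \<open>x\<close>, the form takes a negative value on a suitable combination of
  \<open>z\<close> and \<open>x\<close>; the coefficients below avoid division, so that the lemma serves \<open>\<int>\<close> as well
  as \<open>\<real>\<close>.\<close>

lemma psd_radical:
  fixes B :: "nat \<Rightarrow> nat \<Rightarrow> 'a::linordered_idom"
  assumes sym: "\<And>i j. i < n \<Longrightarrow> j < n \<Longrightarrow> B i j = B j i"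
    and psd: "\<And>x. 0 \<le> ip n B x x" and x: "ip n B x x = 0"
  shows "ip n B z x = 0"
proof (rule ccontr)
  assume ne: "ip n B z x \<noteq> 0"
  let ?c = "ip n B z x" and ?t = "ip n B z z + 1"
  have "0 \<le> ip n B (\<lambda>j. ?c * z j - ?t * x j) (\<lambda>j. ?c * z j - ?t * x j)" by (rule psd)
  also have "\<dots> = ?c\<^sup>2 * ip n B z z - 2 * ?c * ?t * ip n B z x + ?t\<^sup>2 * ip n B x x"
    by (rule ip_scaled_diff[OF sym])
  also have "\<dots> = - (?c\<^sup>2 * (ip n B z z + 2))"
    by (simp add: x power2_eq_square algebra_simps)
  finally have "?c\<^sup>2 * (ip n B z z + 2) \<le> 0" by simp
  moreover have "0 < ?c\<^sup>2 * (ip n B z z + 2)" using ne psd[of z] by (intro mult_pos_pos) auto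
  ultimately show False by simp
qed

lemma cauchy_schwarz:
  fixes B :: "nat \<Rightarrow> nat \<Rightarrow> 'a::linordered_idom"
  assumes sym: "\<And>i j. i < n \<Longrightarrow> j < n \<Longrightarrow> B i j = B j i"
    and psd: "\<And>x. 0 \<le> ip n B x x" and y: "0 < ip n B y y"
  shows "(ip n B x y)\<^sup>2 \<le> ip n B x x * ip n B y y"
proof -
  let ?s = "ip n B y y" and ?t = "ip n B x y"
  have "0 \<le> ip n B (\<lambda>j. ?s * x j - ?t * y j) (\<lambda>j. ?s * x j - ?t * y j)" by (rule psd)
  also have "\<dots> = ?s\<^sup>2 * ip n B x x - 2 * ?s * ?t * ip n B x y + ?t\<^sup>2 * ip n B y y"
    by (rule ip_scaled_diff[OF sym])
  also have "\<dots> = ?s * (ip n B x x * ?s - ?t\<^sup>2)"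
    by (simp add: power2_eq_square algebra_simps)
  finally show ?thesis using y by (simp add: zero_le_mult_iff)
qed

text \<open>Uniqueness of digits in base \<open>M\<close>: modulo \<open>M\<close> the sum is its lowest digit.\<close>

lemma digits_unique_zero:
  fixes c :: "nat \<Rightarrow> int"
  assumes "(\<Sum>k<n. M ^ k * c k) = 0" "\<And>k. k < n \<Longrightarrow> \<bar>c k\<bar> < M" "k < n"
  shows "c k = 0"
  using assms
proof (induction n arbitrary: c k)
  case (Suc n)
  have M: "M > 0" using Suc.prems(2)[of 0] by simp
  have s: "c 0 + M * (\<Sum>k<n. M ^ k * c (Suc k)) = 0"
    using Suc.prems(1) by (simp add: sum.lessThan_Suc_shift sum_distrib_left mult.assoc del: sum.lessThan_Suc)
  then have "M dvd c 0" by (metis dvd_add_left_iff dvd_triv_left dvd_0_right)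
  then have c0: "c 0 = 0" using Suc.prems(2)[of 0]
    by (metis M zero_less_Suc abs_of_pos dvd_imp_le_int linorder_not_le)
  with s M have "(\<Sum>k<n. M ^ k * c (Suc k)) = 0" by simp
  then have "c (Suc k) = 0" if "k < n" for k
  proof (rule Suc.IH)
    show "\<bar>c (Suc j)\<bar> < M" if "j < n" for j using Suc.prems(2)[of "Suc j"] that by blast
  qed (use that in blast)
  with c0 Suc.prems(3) show ?case by (cases k) auto
qed simp

section \<open>Tuples of roots and braid moves\<close>

text \<open>The lattice spanned by a SIM-root basis: \<open>B\<close> is the symmetrized matrix, \<open>d\<close> the symmetrizer, and
  \<open>B i j / d i\<close> the matrix entry.\<close>

locale sim_lattice =
  fixes n :: nat and B :: "nat \<Rightarrow> nat \<Rightarrow> int" and d :: "nat \<Rightarrow> nat"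
  assumes B_sym: "\<And>i j. i < n \<Longrightarrow> j < n \<Longrightarrow> B i j = B j i"
    and B_diag: "\<And>i. i < n \<Longrightarrow> B i i = 2 * int (d i)"
    and d_pos: "\<And>i. i < n \<Longrightarrow> 0 < d i"
    and d_dvd: "\<And>i j. i < n \<Longrightarrow> j < n \<Longrightarrow> int (d i) dvd B i j"
    and psd_real: "\<And>x. 0 \<le> ip n (\<lambda>i j. real_of_int (B i j)) x x"
begin

abbreviation pair :: "(nat \<Rightarrow> int) \<Rightarrow> (nat \<Rightarrow> int) \<Rightarrow> int" where
  "pair \<equiv> ip n B"

lemma pair_commute: "pair x y = pair y x"
  by (rule ip_commute[OF B_sym])

lemma psd_int: "0 \<le> pair x x"
  using psd_real[of "\<lambda>i. real_of_int (x i)"] by (simp add: ip_of_int)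

lemma pair_sq_le: "0 < pair y y \<Longrightarrow> (pair x y)\<^sup>2 \<le> pair x x * pair y y"
  by (rule cauchy_schwarz[OF B_sym psd_int])

lemma pair_radical: "pair x x = 0 \<Longrightarrow> pair z x = 0"
  by (rule psd_radical[OF B_sym psd_int])

text \<open>The coefficients of \<open>h\<close> are powers of a large base \<open>K\<close>. The numbers \<open>(\<alpha>\<^sub>k,x)\<close> are then the digits
  of \<open>(h,x)\<close>, since Cauchy-Schwarz bounds them by norms of basis vectors; if \<open>(h,x)\<close>
  vanishes, so do all of them, and \<open>x\<close> is isotropic.\<close>

lemma generic_vector:
  obtains h where "\<And>x i. i < n \<Longrightarrow> pair x x = 2 * int (d i) \<Longrightarrow> pair h x \<noteq> 0"
proof -
  define K where "K = (\<Sum>i<n. 2 * int (d i)) + 1"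
  define h where "h k = K ^ k" for k
  have "pair h x \<noteq> 0" if i: "i < n" and x: "pair x x = 2 * int (d i)" for x i
  proof
    assume 0: "pair h x = 0"
    define c where "c k = (\<Sum>j<n. B k j * x j)" for k
    have hx: "pair h x = (\<Sum>k<n. K ^ k * c k)"
      unfolding ip_def h_def c_def by (simp add: sum_distrib_left mult.assoc)
    have le: "2 * int (d k) < K" if "k < n" for k
      using member_le_sum[of k "{..<n}" "\<lambda>i. 2 * int (d i)"] that unfolding K_def by simp
    have bound: "\<bar>c k\<bar> < K" if k: "k < n" for k
    proof -
      have ck: "c k = pair (delta k) x" using k by (simp add: c_def ip_delta_left)
      have "(c k)\<^sup>2 \<le> pair (delta k) (delta k) * pair x x"
        unfolding ck by (rule pair_sq_le) (use x d_pos[OF i] in simp)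
      also have "\<dots> = (2 * int (d k)) * (2 * int (d i))"
        using k by (simp add: ip_delta B_diag x)
      also have "\<dots> < K * K" using le[OF k] le[OF i] by (intro mult_strict_mono) auto
      finally have "(c k)\<^sup>2 < K\<^sup>2" by (simp add: power2_eq_square)
      moreover have "0 < K" using le[OF k] by linarith
      ultimately show ?thesis by (metis abs_of_pos abs_le_square_iff not_le)
    qed
    have "c k = 0" if "k < n" for k
      using digits_unique_zero[of K c n k] bound 0 hx that by simp
    then have "pair x x = 0"
      unfolding ip_def c_def by (simp add: mult.assoc flip: sum_distrib_left)
    with x d_pos[OF i] show False by simp
  qed
  then show thesis using that by blast
qed

text \<open>These conditions express that \<open>\<beta>\<close> is a SIM-root basis with the symmetrizer \<open>d\<close>. The last one says
  that \<open>\<beta>\<close> generates the lattice, in a form that a change of one entry preserves visibly and that can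
  be applied to any property closed under integral combinations.\<close>

definition admissible :: "(nat \<Rightarrow> nat \<Rightarrow> int) \<Rightarrow> bool" where
  "admissible \<beta> \<longleftrightarrow>
     (\<forall>i<n. pair (\<beta> i) (\<beta> i) = 2 * int (d i)) \<and>
     (\<forall>i<n. \<forall>j<n. int (d i) dvd pair (\<beta> i) (\<beta> j)) \<and>
     (\<forall>S. (\<forall>x\<in>S. \<forall>y\<in>S. \<forall>k. (\<lambda>j. x j - k * y j) \<in> S) \<longrightarrow>
        (\<forall>i<n. \<beta> i \<in> S) \<longrightarrow> (\<forall>i<n. delta i \<in> S))"

lemma admissible_generates:
  assumes "admissible \<beta>" and i: "i < n"
    and S: "\<And>x y k. x \<in> S \<Longrightarrow> y \<in> S \<Longrightarrow> (\<lambda>j. x j - k * y j) \<in> S"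
    and \<beta>: "\<And>i. i < n \<Longrightarrow> \<beta> i \<in> S"
  shows "delta i \<in> S"
proof -
  have "(\<forall>x\<in>S. \<forall>y\<in>S. \<forall>k. (\<lambda>j. x j - k * y j) \<in> S) \<longrightarrow>
      (\<forall>i<n. \<beta> i \<in> S) \<longrightarrow> (\<forall>i<n. delta i \<in> S)"
    using assms(1) unfolding admissible_def by (elim conjE) (erule spec)
  with S \<beta> i show ?thesis by simp
qed

lemma admissible_delta: "admissible delta"
  unfolding admissible_def by (simp add: ip_delta B_diag d_dvd)

text \<open>The braid-transformation \<open>\<tau>\<^sub>a\<^sub>,\<^sub>b\<close>; by admissibility the division by \<open>d a = (\<beta> a, \<beta> a) / 2\<close>
  is exact.\<close>

definition move :: "nat \<Rightarrow> nat \<Rightarrow> (nat \<Rightarrow> nat \<Rightarrow> int) \<Rightarrow> nat \<Rightarrow> nat \<Rightarrow> int" where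
  "move a b \<beta> = \<beta>(b := (\<lambda>j. \<beta> b j - (pair (\<beta> a) (\<beta> b) div int (d a)) * \<beta> a j))"

text \<open>A reflection preserves the norm. For divisibility, the new pairing of \<open>\<beta> b\<close> with \<open>\<beta> j\<close>
  contains the product of the pairing of \<open>\<beta> a\<close> with \<open>\<beta> b\<close> and an integer, which \<open>d b\<close> divides. The
  lattice generated is the same because a move can be undone.\<close>

lemma admissible_move:
  assumes adm: "admissible \<beta>" and a: "a < n" and b: "b < n"
  shows "admissible (move a b \<beta>)"
proof -
  define k where "k = pair (\<beta> a) (\<beta> b) div int (d a)"
  have nrm: "pair (\<beta> i) (\<beta> i) = 2 * int (d i)" if "i < n" for i
    using adm that by (simp add: admissible_def)
  have dv: "int (d i) dvd pair (\<beta> i) (\<beta> j)" if "i < n" "j < n" for i j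
    using adm that by (simp add: admissible_def)
  have k: "pair (\<beta> a) (\<beta> b) = int (d a) * k" "pair (\<beta> b) (\<beta> a) = int (d a) * k"
    using dv[OF a b] by (simp_all add: k_def pair_commute[of "\<beta> b"])
  have mv: "move a b \<beta> = \<beta>(b := (\<lambda>j. \<beta> b j - k * \<beta> a j))"
    by (simp add: move_def k_def)
  have nb: "pair (move a b \<beta> b) (move a b \<beta> b) = 2 * int (d b)"
    by (simp add: mv ip_diff_left ip_diff_right k nrm a b algebra_simps)
  have "pair (move a b \<beta> i) (move a b \<beta> i) = 2 * int (d i)" if "i < n" for i
    using nb nrm[OF that] by (cases "i = b") (simp_all add: mv)
  moreover have "int (d i) dvd pair (move a b \<beta> i) (move a b \<beta> j)" if ij: "i < n" "j < n" for i j
  proof -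
    have 1: "int (d b) dvd k * pair (\<beta> a) (\<beta> j)"
    proof -
      obtain u where u: "pair (\<beta> a) (\<beta> j) = int (d a) * u" using dv[OF a ij(2)] by (auto elim: dvdE)
      have "int (d b) dvd pair (\<beta> b) (\<beta> a) * u" using dv[OF b a] by simp
      also have "pair (\<beta> b) (\<beta> a) * u = k * pair (\<beta> a) (\<beta> j)" by (simp add: u k)
      finally show ?thesis .
    qed
    show ?thesis
    proof (cases "i = b"; cases "j = b")
      assume "i = b" "j = b" then show ?thesis using nb by simp
    next
      assume "i = b" "j \<noteq> b" then show ?thesis using 1 dv[OF b ij(2)] by (simp add: mv ip_diff_left)
    next
      assume "i \<noteq> b" "j = b" then show ?thesis using dv[OF ij(1) a] dv[OF ij(1) b] by (simp add: mv ip_diff_right)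
    next
      assume "i \<noteq> b" "j \<noteq> b" then show ?thesis using dv[OF ij] by (simp add: mv)
    qed
  qed
  moreover have "\<forall>i<n. delta i \<in> S"
    if S: "\<forall>x\<in>S. \<forall>y\<in>S. \<forall>k. (\<lambda>j. x j - k * y j) \<in> S" and m: "\<forall>i<n. move a b \<beta> i \<in> S" for S
  proof -
    have ne: "\<beta> i \<in> S" if "i < n" "i \<noteq> b" for i
      using m that by (auto simp: mv)
    have "\<beta> b \<in> S"
    proof (cases "a = b")
      case True
      \<comment> \<open>Here the move only changes the sign of \<open>\<beta> b\<close>.\<close>
      have "k = 2" using k(1) nrm[OF a] d_pos[OF a] True by simp
      then have e: "\<beta> b = (\<lambda>j. move a b \<beta> b j - 2 * move a b \<beta> b j)"
        unfolding mv using True \<open>k = 2\<close> by auto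
      show ?thesis by (subst e) (use S m b in blast)
    next
      case False
      then have e: "\<beta> b = (\<lambda>j. move a b \<beta> b j - (- k) * \<beta> a j)"
        by (auto simp: mv)
      show ?thesis by (subst e) (use S m b ne[OF a] False in blast)
    qed
    with ne have "\<forall>i<n. \<beta> i \<in> S" by blast
    with S show ?thesis using adm unfolding admissible_def by blast
  qed
  ultimately show ?thesis unfolding admissible_def by (intro conjI allI impI) simp_all
qed

inductive reachable :: "(nat \<Rightarrow> nat \<Rightarrow> int) \<Rightarrow> bool" where
  start: "reachable delta"
| move: "reachable \<beta> \<Longrightarrow> a < n \<Longrightarrow> b < n \<Longrightarrow> reachable (move a b \<beta>)"

lemma reachable_admissible: "reachable \<beta> \<Longrightarrow> admissible \<beta>"
  by (induction rule: reachable.induct) (auto intro: admissible_delta admissible_move)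

text \<open>A tuple of minimal total height: no pair with positive product can be lowered, hence any such pair
  satisfies the Cauchy-Schwarz inequality with equality.\<close>

lemma reachable_reduced:
  obtains \<beta> h where "reachable \<beta>" and "\<And>i. i < n \<Longrightarrow> 0 < pair h (\<beta> i)"
    and "\<And>a b. a < n \<Longrightarrow> b < n \<Longrightarrow> 0 < pair (\<beta> a) (\<beta> b) \<Longrightarrow>
           (pair (\<beta> a) (\<beta> b))\<^sup>2 = 4 * int (d a) * int (d b)"
proof -
  obtain h where h: "\<And>x i. i < n \<Longrightarrow> pair x x = 2 * int (d i) \<Longrightarrow> pair h x \<noteq> 0"
    using generic_vector by blast
  \<comment> \<open>Twice the absolute height, with a penalty of one for a negative root: changing the sign of such
    a root lowers the total, and a lower absolute value outweighs any penalty.\<close>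
  define \<phi> where "\<phi> t = nat (if t < 0 then 1 - 2 * t else 2 * t)" for t :: int
  define \<mu> where "\<mu> \<beta> = (\<Sum>i<n. \<phi> (pair h (\<beta> i)))" for \<beta>
  obtain \<beta> where r: "reachable \<beta>" and min: "\<And>\<gamma>. reachable \<gamma> \<Longrightarrow> \<mu> \<beta> \<le> \<mu> \<gamma>"
    using ex_has_least_nat[of reachable delta \<mu>] reachable.start by blast
  have adm: "admissible \<beta>" by (rule reachable_admissible[OF r])
  have nrm: "pair (\<beta> i) (\<beta> i) = 2 * int (d i)" if "i < n" for i
    using adm that by (simp add: admissible_def)
  have dv: "int (d i) dvd pair (\<beta> i) (\<beta> j)" if "i < n" "j < n" for i j
    using adm that by (simp add: admissible_def)
  \<comment> \<open>A move changes one summand only.\<close>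
  have local_min: "\<phi> (pair h (\<beta> b)) \<le> \<phi> (pair h (\<beta> b) - k * pair h (\<beta> a))"
    if a: "a < n" and b: "b < n" and k: "pair (\<beta> a) (\<beta> b) = int (d a) * k" for a b k
  proof -
    have kk: "pair (\<beta> a) (\<beta> b) div int (d a) = k" using k d_pos[OF a] by simp
    have m: "move a b \<beta> = \<beta>(b := (\<lambda>j. \<beta> b j - k * \<beta> a j))" by (simp add: move_def kk)
    have "\<mu> \<beta> \<le> \<mu> (move a b \<beta>)" by (rule min) (intro reachable.move r a b)
    moreover have "\<mu> \<gamma> = \<phi> (pair h (\<gamma> b)) + (\<Sum>i\<in>{..<n} - {b}. \<phi> (pair h (\<gamma> i)))" for \<gamma>
      unfolding \<mu>_def using b by (simp add: sum.remove)
    moreover have "(\<Sum>i\<in>{..<n} - {b}. \<phi> (pair h (move a b \<beta> i))) = (\<Sum>i\<in>{..<n} - {b}. \<phi> (pair h (\<beta> i)))"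
      by (rule sum.cong) (auto simp: m)
    ultimately show ?thesis by (simp add: m ip_diff_right)
  qed
  have pos: "0 < pair h (\<beta> i)" if i: "i < n" for i
  proof -
    have "\<phi> (pair h (\<beta> i)) \<le> \<phi> (pair h (\<beta> i) - 2 * pair h (\<beta> i))"
      by (rule local_min[OF i i]) (simp add: nrm i)
    moreover have "pair h (\<beta> i) \<noteq> 0" using h i nrm by blast
    ultimately show ?thesis unfolding \<phi>_def by (auto split: if_splits)
  qed
  have shrink: "2 * pair h (\<beta> b) \<le> k * pair h (\<beta> a)"
    if a: "a < n" and b: "b < n" and k: "pair (\<beta> a) (\<beta> b) = int (d a) * k" and "k > 0" for a b k
  proof -
    have "0 < k * pair h (\<beta> a)" using \<open>k > 0\<close> pos[OF a] by simp
    with local_min[OF a b k] pos[OF b] show ?thesis unfolding \<phi>_def by (auto split: if_splits)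
  qed
  have par: "(pair (\<beta> a) (\<beta> b))\<^sup>2 = 4 * int (d a) * int (d b)"
    if a: "a < n" and b: "b < n" and g: "0 < pair (\<beta> a) (\<beta> b)" for a b
  proof -
    obtain p where p: "pair (\<beta> a) (\<beta> b) = int (d a) * p" using dv[OF a b] by (auto elim: dvdE)
    obtain q where q: "pair (\<beta> b) (\<beta> a) = int (d b) * q" using dv[OF b a] by (auto elim: dvdE)
    have g': "0 < pair (\<beta> b) (\<beta> a)" using g by (simp add: pair_commute)
    have p0: "p > 0" and q0: "q > 0" using g p g' q by (auto simp: zero_less_mult_iff)
    have 1: "2 * pair h (\<beta> b) \<le> p * pair h (\<beta> a)" by (rule shrink[OF a b p p0])
    have 2: "2 * pair h (\<beta> a) \<le> q * pair h (\<beta> b)" by (rule shrink[OF b a q q0])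
    have "4 * pair h (\<beta> a) \<le> q * (2 * pair h (\<beta> b))" using 2 by simp
    also have "\<dots> \<le> q * (p * pair h (\<beta> a))" using 1 q0 by (intro mult_left_mono) auto
    finally have "4 * pair h (\<beta> a) \<le> (p * q) * pair h (\<beta> a)" by (simp add: ac_simps)
    then have pq: "4 \<le> p * q" using pos[OF a] by simp
    have sq: "(pair (\<beta> a) (\<beta> b))\<^sup>2 = (int (d a) * int (d b)) * (p * q)"
    proof -
      have "(pair (\<beta> a) (\<beta> b))\<^sup>2 = pair (\<beta> a) (\<beta> b) * pair (\<beta> b) (\<beta> a)"
        by (simp add: power2_eq_square pair_commute)
      then show ?thesis by (simp only: p q ac_simps)
    qed
    have "(pair (\<beta> a) (\<beta> b))\<^sup>2 \<le> (int (d a) * int (d b)) * 4"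
      using pair_sq_le[of "\<beta> b" "\<beta> a"] nrm[OF a] nrm[OF b] d_pos[OF b] by simp
    moreover have "(int (d a) * int (d b)) * 4 \<le> (int (d a) * int (d b)) * (p * q)"
      using pq by (intro mult_left_mono) auto
    ultimately have "(pair (\<beta> a) (\<beta> b))\<^sup>2 = (int (d a) * int (d b)) * 4" using sq by linarith
    then show ?thesis by simp
  qed
  show thesis using that[OF r pos par] .
qed

section \<open>The simple roots of a reduced tuple\<close>

text \<open>Equality in Cauchy-Schwarz means that \<open>2d\<^sub>a\<beta>\<^sub>b - (\<beta>\<^sub>a,\<beta>\<^sub>b)\<beta>\<^sub>a\<close> is isotropic, hence in the
  radical.\<close>

lemma parallel_pair:
  assumes adm: "admissible \<beta>" and a: "a < n" and b: "b < n"
    and par: "(pair (\<beta> a) (\<beta> b))\<^sup>2 = 4 * int (d a) * int (d b)"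
  shows "2 * int (d a) * pair z (\<beta> b) = pair (\<beta> a) (\<beta> b) * pair z (\<beta> a)"
proof -
  let ?g = "pair (\<beta> a) (\<beta> b)" and ?s = "2 * int (d a)"
  let ?w = "\<lambda>j. ?s * \<beta> b j - ?g * \<beta> a j"
  have nrm: "pair (\<beta> a) (\<beta> a) = 2 * int (d a)" "pair (\<beta> b) (\<beta> b) = 2 * int (d b)"
    using adm a b by (simp_all add: admissible_def)
  have "pair ?w ?w = ?s\<^sup>2 * pair (\<beta> b) (\<beta> b) - 2 * ?s * ?g * pair (\<beta> b) (\<beta> a) + ?g\<^sup>2 * pair (\<beta> a) (\<beta> a)"
    by (rule ip_scaled_diff[OF B_sym])
  also have "\<dots> = ?s\<^sup>2 * (2 * int (d b)) - ?s * ?g\<^sup>2"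
    by (simp add: nrm pair_commute[of "\<beta> b" "\<beta> a"] power2_eq_square algebra_simps)
  also have "\<dots> = 0" using par by (simp add: power2_eq_square)
  finally have "pair z ?w = 0" by (rule pair_radical)
  moreover have "pair z ?w = ?s * pair z (\<beta> b) - ?g * pair z (\<beta> a)"
    using ip_diff_right[of n B z "\<lambda>j. ?s * \<beta> b j" ?g "\<beta> a"]
    by (simp add: ip_def sum_distrib_left ac_simps)
  ultimately show ?thesis by simp
qed

text \<open>Vectors in an open half space that pairwise enclose non-acute angles are independent modulo the
  radical. For a relation with coefficients \<open>x\<close>, replacing \<open>x\<close> by \<open>|x|\<close> can only decrease the
  norm, as the mixed terms are non-positive; so the combination with coefficients \<open>|x|\<close>
  is isotropic as well. Its height is zero although each of its terms is non-negative.\<close>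

lemma obtuse_independent:
  fixes x :: "nat \<Rightarrow> real"
  assumes fin: "finite J"
    and pos: "\<And>i. i \<in> J \<Longrightarrow> 0 < pair h (\<beta> i)"
    and obtuse: "\<And>i j. i \<in> J \<Longrightarrow> j \<in> J \<Longrightarrow> i \<noteq> j \<Longrightarrow> pair (\<beta> i) (\<beta> j) \<le> 0"
    and zero: "(\<Sum>i\<in>J. \<Sum>j\<in>J. x i * real_of_int (pair (\<beta> i) (\<beta> j)) * x j) = 0"
    and i: "i \<in> J"
  shows "x i = 0"
proof -
  let ?B = "\<lambda>i j. real_of_int (B i j)"
  define w where "w k = (\<Sum>i\<in>J. \<bar>x i\<bar> * real_of_int (\<beta> i k))" for k
  have pr: "ip n ?B (\<lambda>k. real_of_int (y k)) (\<lambda>k. real_of_int (z k)) = real_of_int (pair y z)" for y z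
    by (rule ip_of_int)
  have "ip n ?B w w = (\<Sum>i\<in>J. \<Sum>j\<in>J. \<bar>x i\<bar> * real_of_int (pair (\<beta> i) (\<beta> j)) * \<bar>x j\<bar>)"
    unfolding w_def ip_sum_left ip_sum_right pr by (simp add: sum_distrib_left ac_simps)
  also have "\<dots> \<le> (\<Sum>i\<in>J. \<Sum>j\<in>J. x i * real_of_int (pair (\<beta> i) (\<beta> j)) * x j)"
  proof (intro sum_mono)
    fix i j assume ij: "i \<in> J" "j \<in> J"
    show "\<bar>x i\<bar> * real_of_int (pair (\<beta> i) (\<beta> j)) * \<bar>x j\<bar> \<le> x i * real_of_int (pair (\<beta> i) (\<beta> j)) * x j"
    proof (cases "i = j")
      case True
      have "\<bar>x j\<bar> * g * \<bar>x j\<bar> = x j * g * x j" for g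
        by (metis abs_mult_self_eq mult.assoc mult.commute)
      with True show ?thesis by simp
    next
      case False
      have "(x i * x j) \<le> \<bar>x i\<bar> * \<bar>x j\<bar>" by (metis abs_ge_self abs_mult)
      then have "real_of_int (pair (\<beta> i) (\<beta> j)) * (\<bar>x i\<bar> * \<bar>x j\<bar>) \<le> real_of_int (pair (\<beta> i) (\<beta> j)) * (x i * x j)"
        using obtuse[OF ij False] by (intro mult_left_mono_neg) auto
      then show ?thesis by (simp add: ac_simps)
    qed
  qed
  finally have "ip n ?B w w = 0" using zero psd_real[of w] by simp
  then have "ip n ?B (\<lambda>k. real_of_int (h k)) w = 0"
    by (rule psd_radical[rotated 2]) (simp_all add: psd_real B_sym)
  then have "(\<Sum>i\<in>J. \<bar>x i\<bar> * real_of_int (pair h (\<beta> i))) = 0"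
    unfolding w_def ip_sum_right pr .
  then have "\<bar>x i\<bar> * real_of_int (pair h (\<beta> i)) = 0"
    using sum_nonneg_eq_0_iff[OF fin, of "\<lambda>i. \<bar>x i\<bar> * real_of_int (pair h (\<beta> i))"] pos i
    by (simp add: less_imp_le)
  with pos[OF i] show ?thesis by simp
qed

text \<open>Having positive product is transitive on a reduced tuple, and \<open>J\<close> selects from each class
  the root of least norm; \<open>\<rho>\<close> sends an index to the representative of its class. The root \<open>\<beta> i\<close> is
  \<open>c i\<close> times its representative modulo the radical: the Cartan integers \<open>p\<close> and \<open>q\<close> of the two have
  product 4, and as the representative is not longer, \<open>(p,q)\<close> is \<open>(2,2)\<close> or \<open>(4,1)\<close>, with
  \<open>c = p/2\<close>.\<close>

lemma reachable_simple_subsystem: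
  obtains \<beta> J \<rho> c where "reachable \<beta>" and "J \<subseteq> {..<n}"
    and "\<And>i. i < n \<Longrightarrow> \<rho> i \<in> J" and "\<And>i. i \<in> J \<Longrightarrow> \<rho> i = i \<and> c i = 1"
    and "\<And>i. i < n \<Longrightarrow> c i = 1 \<or> c i = 2"
    and "\<And>i z. i < n \<Longrightarrow> pair z (\<beta> i) = c i * pair z (\<beta> (\<rho> i))"
    and "\<And>i j. i \<in> J \<Longrightarrow> j \<in> J \<Longrightarrow> i \<noteq> j \<Longrightarrow> pair (\<beta> i) (\<beta> j) \<le> 0"
    and "\<And>x :: nat \<Rightarrow> real. (\<Sum>i\<in>J. \<Sum>j\<in>J. x i * real_of_int (pair (\<beta> i) (\<beta> j)) * x j) = 0 \<Longrightarrow>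
           \<forall>i\<in>J. x i = 0"
proof -
  obtain \<beta> h where r: "reachable \<beta>" and pos: "\<And>i. i < n \<Longrightarrow> 0 < pair h (\<beta> i)"
    and sq: "\<And>a b. a < n \<Longrightarrow> b < n \<Longrightarrow> 0 < pair (\<beta> a) (\<beta> b) \<Longrightarrow>
           (pair (\<beta> a) (\<beta> b))\<^sup>2 = 4 * int (d a) * int (d b)"
    using reachable_reduced by blast
  have adm: "admissible \<beta>" by (rule reachable_admissible[OF r])
  have nrm: "pair (\<beta> i) (\<beta> i) = 2 * int (d i)" if "i < n" for i
    using adm that by (simp add: admissible_def)
  have dv: "int (d i) dvd pair (\<beta> i) (\<beta> j)" if "i < n" "j < n" for i j
    using adm that by (simp add: admissible_def)
  have par: "2 * int (d a) * pair z (\<beta> b) = pair (\<beta> a) (\<beta> b) * pair z (\<beta> a)"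
    if "a < n" "b < n" "0 < pair (\<beta> a) (\<beta> b)" for a b z
    using parallel_pair[OF adm that(1,2) sq[OF that]] .
  have trans: "0 < pair (\<beta> i) (\<beta> k)"
    if "i < n" "j < n" "k < n" "0 < pair (\<beta> i) (\<beta> j)" "0 < pair (\<beta> j) (\<beta> k)" for i j k
  proof -
    have "0 < pair (\<beta> j) (\<beta> k) * pair (\<beta> i) (\<beta> j)" using that by simp
    then have "0 < 2 * int (d j) * pair (\<beta> i) (\<beta> k)" using par[OF that(2,3,5)] by simp
    then show ?thesis using d_pos[OF that(2)] by (simp add: zero_less_mult_iff)
  qed
  \<comment> \<open>Orders the indices by norm, with ties broken by the index itself.\<close>
  define key where "key i = d i * n + i" for i
  have key: "d i \<le> d j" if "i < n" "j < n" "key i \<le> key j" for i j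
  proof (rule ccontr)
    assume "\<not> d i \<le> d j"
    then have "(d j + 1) * n \<le> d i * n" by (intro mult_le_mono1) simp
    with that show False unfolding key_def by simp
  qed
  define J where "J = {j. j < n \<and> (\<forall>i<n. 0 < pair (\<beta> j) (\<beta> i) \<longrightarrow> key j \<le> key i)}"
  have uniq: "i = j" if "i \<in> J" "j \<in> J" "0 < pair (\<beta> i) (\<beta> j)" for i j
  proof -
    have ij: "i < n" "j < n" using that by (auto simp: J_def)
    have "0 < pair (\<beta> j) (\<beta> i)" using that(3) by (subst pair_commute)
    then have "key j \<le> key i" using that(2) ij by (simp add: J_def)
    moreover have "key i \<le> key j" using that(1,3) ij by (simp add: J_def)
    ultimately have "key i = key j" by simp
    moreover from this have "d i = d j" using key[OF ij] key[OF ij(2,1)] by simp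
    ultimately show ?thesis by (simp add: key_def)
  qed
  have "\<exists>j\<in>J. 0 < pair (\<beta> j) (\<beta> i) \<and> d j \<le> d i" if i: "i < n" for i
  proof -
    let ?P = "\<lambda>j. j < n \<and> 0 < pair (\<beta> i) (\<beta> j)"
    have Pi: "?P i" using i nrm d_pos by simp
    obtain j where j: "?P j" and min: "\<And>k. ?P k \<Longrightarrow> key j \<le> key k"
      using ex_has_least_nat[of ?P i key] Pi by blast
    have "j \<in> J" unfolding J_def using j min trans[OF i, of j] by blast
    moreover have "d j \<le> d i" using key j i min[OF Pi] by blast
    ultimately show ?thesis using j pair_commute[of "\<beta> i" "\<beta> j"] by auto
  qed
  then obtain \<rho> where \<rho>: "\<And>i. i < n \<Longrightarrow> \<rho> i \<in> J \<and> 0 < pair (\<beta> (\<rho> i)) (\<beta> i) \<and> d (\<rho> i) \<le> d i"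
    by metis
  have "\<exists>c. (c = 1 \<or> c = 2) \<and> (\<forall>z. pair z (\<beta> i) = c * pair z (\<beta> (\<rho> i)))" if i: "i < n" for i
  proof -
    define j where "j = \<rho> i"
    have j: "j < n" and g: "0 < pair (\<beta> j) (\<beta> i)" and le: "d j \<le> d i"
      using \<rho>[OF i] by (auto simp: j_def J_def)
    have dj: "0 < int (d j)" and di: "0 < int (d i)" using d_pos i j by simp_all
    obtain p where p: "pair (\<beta> j) (\<beta> i) = int (d j) * p" using dv[OF j i] by (auto elim: dvdE)
    obtain q where q: "pair (\<beta> j) (\<beta> i) = int (d i) * q"
      using dv[OF i j] pair_commute[of "\<beta> i"] by (auto elim: dvdE)
    have p0: "0 < p" and q0: "0 < q" using g p q dj di by (metis zero_less_mult_pos)+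
    have "(int (d j) * int (d i)) * (p * q) = (int (d j) * int (d i)) * 4"
      using sq[OF j i g] by (metis p q power2_eq_square mult.assoc mult.left_commute mult.commute)
    then have pq: "p * q = 4" using dj di by simp
    have "q \<le> p"
    proof (rule ccontr)
      assume "\<not> q \<le> p"
      then have "int (d j) * p < int (d j) * q" using dj by simp
      also have "\<dots> \<le> int (d i) * q" using le q0 by (intro mult_right_mono) auto
      finally show False using p q by simp
    qed
    have "p = 2 \<or> p = 4"
    proof -
      have "q \<le> 2"
      proof (rule ccontr)
        assume "\<not> q \<le> 2"
        then have "3 * 3 \<le> p * q" using \<open>q \<le> p\<close> by (intro mult_mono) auto
        with pq show False by simp
      qed
      then have "q = 1 \<or> q = 2" using q0 by auto
      with pq show ?thesis by auto
    qed
    then obtain c where c: "p = 2 * c" "c = 1 \<or> c = 2" by (metis mult_2 mult.right_neutral mult_2_right numeral_Bit0 one_add_one)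
    have "pair z (\<beta> i) = c * pair z (\<beta> j)" for z
    proof -
      have "(2 * int (d j)) * pair z (\<beta> i) = (2 * int (d j)) * (c * pair z (\<beta> j))"
        using par[OF j i g, of z] by (simp add: p c)
      then show ?thesis using dj by simp
    qed
    with c show ?thesis unfolding j_def by blast
  qed
  then obtain c where c: "\<And>i. i < n \<Longrightarrow> (c i = 1 \<or> c i = 2) \<and> (\<forall>z. pair z (\<beta> i) = c i * pair z (\<beta> (\<rho> i)))"
    by metis
  have self: "\<rho> i = i \<and> c i = 1" if i: "i \<in> J" for i
  proof -
    have n: "i < n" using i by (simp add: J_def)
    have "\<rho> i = i" using uniq[of "\<rho> i" i] \<rho>[OF n] i by blast
    then have "pair (\<beta> i) (\<beta> i) = c i * pair (\<beta> i) (\<beta> i)" using c[OF n] by metis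
    then show ?thesis using nrm[OF n] d_pos[OF n] \<open>\<rho> i = i\<close> by simp
  qed
  show thesis
  proof (rule that[OF r])
    show "J \<subseteq> {..<n}" by (auto simp: J_def)
    show obt: "pair (\<beta> i) (\<beta> j) \<le> 0" if "i \<in> J" "j \<in> J" "i \<noteq> j" for i j
      using uniq that by force
    show "\<forall>i\<in>J. x i = 0"
      if "(\<Sum>i\<in>J. \<Sum>j\<in>J. x i * real_of_int (pair (\<beta> i) (\<beta> j)) * x j) = 0" for x :: "nat \<Rightarrow> real"
    proof
      fix i assume i: "i \<in> J"
      show "x i = 0"
        by (rule obtuse_independent[OF _ _ obt that i, of h]) (use pos in \<open>auto simp: J_def\<close>)
    qed
    show "\<rho> i \<in> J" if "i < n" for i using \<rho>[OF that] by blast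
    show "\<rho> i = i \<and> c i = 1" if "i \<in> J" for i by (rule self[OF that])
    show "c i = 1 \<or> c i = 2" if "i < n" for i using c[OF that] by blast
    show "pair z (\<beta> i) = c i * pair z (\<beta> (\<rho> i))" if "i < n" for i z using c[OF that] by blast
  qed
qed

end

section \<open>From coordinates to matrices\<close>

lemma mat_vec_ip:
  "vec n x \<bullet> (mat n n (\<lambda>(i, j). G i j) *\<^sub>v vec n y) = ip n G x y"
  unfolding scalar_prod_def[of "vec n x"] ip_def
  by (auto simp: scalar_prod_def sum_distrib_left mult.assoc lessThan_atLeast0 intro!: sum.cong)

lemma form_mat_vec: "form (mat n n (\<lambda>(i, j). G i j)) (vec n x) (vec n y) = ip n G x y"
  unfolding form_def by (rule mat_vec_ip)

lemma symmetrized_mat: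
  "symmetrized n d (mat n n (\<lambda>(i, j). F i j)) = mat n n (\<lambda>(i, j). of_nat (d i) * F i j)"
  unfolding symmetrized_def by (subst mat_diag_mult_left[of _ n n]) auto

context vec_space
begin

lemma mat_vec_in_span_cols:
  assumes A: "A \<in> carrier_mat n m" and v: "v \<in> carrier_vec m"
  shows "A *\<^sub>v v \<in> span (set (cols A))"
proof -
  have l: "length (cols A) = m" using A by simp
  have c: "\<And>i. i < length (cols A) \<Longrightarrow> cols A ! i \<in> carrier_vec n" using A by auto
  have e: "mat_of_cols n (cols A) = A" using A by auto
  show ?thesis
    using mat_of_cols_mult_as_finsum[of v "cols A", unfolded l, OF v] c l
    unfolding e by auto
qed

text \<open>The rank is the dimension of the column space, so it is the number of columns of any injective
  matrix with the same column space.\<close>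

lemma rank_eqI:
  assumes A: "A \<in> carrier_mat n m" and N: "N \<in> carrier_mat n r"
    and inj: "\<And>v. v \<in> carrier_vec r \<Longrightarrow> N *\<^sub>v v = 0\<^sub>v n \<Longrightarrow> v = 0\<^sub>v r"
    and NA: "\<And>i. i < r \<Longrightarrow> col N i \<in> span (set (cols A))"
    and AN: "\<And>i. i < m \<Longrightarrow> col A i \<in> span (set (cols N))"
  shows "rank A = r"
proof -
  have unit: "N *\<^sub>v unit_vec r i = col N i" if "i < r" for i
    using N that by (intro eq_vecI) auto
  have dist: "distinct (cols N)"
    unfolding distinct_conv_nth
  proof (intro allI impI)
    fix i j assume i: "i < length (cols N)" and j: "j < length (cols N)" and ij: "i \<noteq> j"
    show "cols N ! i \<noteq> cols N ! j"
    proof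
      assume e: "cols N ! i = cols N ! j"
      have ir: "i < r" "j < r" using i j N by auto
      have "N *\<^sub>v (unit_vec r i - unit_vec r j) = 0\<^sub>v n"
        using N ir e by (simp add: mult_minus_distrib_mat_vec[OF N] unit)
      then have "unit_vec r i - unit_vec r j = (0\<^sub>v r :: 'a vec)" by (intro inj) auto
      then have "(unit_vec r i - unit_vec r j :: 'a vec) $ i = 0" using ir by simp
      then show False using ir ij by simp
    qed
  qed
  have "lin_indpt (set (cols N))"
    using lin_depE[OF N _ dist] inj by blast
  then have "rank N = r" by (rule lin_indpt_full_rank[OF N dist])
  moreover have cA: "set (cols A) \<subseteq> carrier_vec n" using A cols_dim by blast
  moreover have cN: "set (cols N) \<subseteq> carrier_vec n" using N cols_dim by blast
  moreover have "set (cols N) \<subseteq> span (set (cols A))"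
    using NA N by (auto simp: cols_def)
  moreover have "set (cols A) \<subseteq> span (set (cols N))"
    using AN A by (auto simp: cols_def)
  ultimately have "span (set (cols A)) = span (set (cols N))"
    by (intro subset_antisym span_subsetI)
  then show ?thesis using \<open>rank N = r\<close> unfolding rank_def by simp
qed

end

lemma ex_permutes_image:
  assumes J: "J \<subseteq> {..<n}"
  obtains p where "p permutes {..<n}" and "p ` {..<card J} = J"
proof -
  have fin: "finite J" using J finite_subset by blast
  have cJ: "card J \<le> n" using card_mono[OF _ J] by simp
  obtain f where f: "bij_betw f {..<card J} J"
    using finite_same_card_bij[of "{..<card J}" J] fin by auto
  obtain g where g: "bij_betw g {card J..<n} ({..<n} - J)"
    using finite_same_card_bij[of "{card J..<n}" "{..<n} - J"] fin J
    by (auto simp: card_Diff_subset)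
  define p where "p x = (if x < card J then f x else if x < n then g x else x)" for x
  have 1: "bij_betw p {..<card J} J"
    using f by (rule bij_betw_cong[THEN iffD1, rotated]) (simp add: p_def)
  have 2: "bij_betw p {card J..<n} ({..<n} - J)"
    using g by (rule bij_betw_cong[THEN iffD1, rotated]) (simp add: p_def)
  have "bij_betw p ({..<card J} \<union> {card J..<n}) (J \<union> ({..<n} - J))"
    using 1 2 by (rule bij_betw_combine) blast
  moreover have "{..<card J} \<union> {card J..<n} = {..<n}" using cJ by auto
  moreover have "J \<union> ({..<n} - J) = {..<n}" using J by blast
  ultimately have "bij_betw p {..<n} {..<n}" by simp
  then have "p permutes {..<n}"
    by (rule bij_imp_permutes) (use cJ in \<open>simp add: p_def\<close>)
  moreover have "p ` {..<card J} = J" using 1 by (simp add: bij_betw_def)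
  ultimately show thesis using that by blast
qed

context sim_lattice
begin

text \<open>The structural matrix of a tuple. Moves keep the norms, hence \<open>d\<close> symmetrizes all these
  matrices.\<close>

definition tuple_mat :: "(nat \<Rightarrow> nat \<Rightarrow> int) \<Rightarrow> rat mat" where
  "tuple_mat \<beta> = mat n n (\<lambda>(i, j). of_int (pair (\<beta> i) (\<beta> j)) / of_nat (d i))"

lemma symmetrized_tuple_mat:
  "symmetrized n d (tuple_mat \<beta>) = mat n n (\<lambda>(i, j). of_int (pair (\<beta> i) (\<beta> j)))"
  unfolding tuple_mat_def symmetrized_mat by (intro eq_matI) (auto dest: d_pos)

lemma symmetrizer_tuple_mat:
  assumes "Gcd (d ` {..<n}) = 1"
  shows "symmetrizer n d (tuple_mat \<beta>)"
  unfolding symmetrizer_def symmetrized_tuple_mat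
  using assms d_pos by (auto intro!: eq_matI simp: pair_commute)

text \<open>A braid step is defined on matrices, in the coordinates of the current basis, whereas \<open>\<beta>\<close> is written
  in the original one. Both describe the same change of the Gram matrix.\<close>

lemma braid_step_move:
  assumes gcd: "Gcd (d ` {..<n}) = 1" and adm: "admissible \<beta>" and a: "a < n" and b: "b < n"
  shows "braid_step n (tuple_mat \<beta>) (tuple_mat (move a b \<beta>))"
proof -
  let ?G = "\<lambda>i j. rat_of_int (pair (\<beta> i) (\<beta> j))"
  let ?M = "mat n n (\<lambda>(i, j). ?G i j)"
  define k where "k = pair (\<beta> a) (\<beta> b) div int (d a)"
  have nrm: "pair (\<gamma> i) (\<gamma> i) = 2 * int (d i)" if "admissible \<gamma>" "i < n" for \<gamma> i
    using that by (simp add: admissible_def)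
  have "int (d a) dvd pair (\<beta> a) (\<beta> b)" using adm a b by (simp add: admissible_def)
  then have k: "pair (\<beta> a) (\<beta> b) = int (d a) * k" by (simp add: k_def)
  have mv: "move a b \<beta> = \<beta>(b := (\<lambda>j. \<beta> b j - k * \<beta> a j))"
    by (simp add: move_def k_def)
  have unit: "unit_vec n i = (vec n (delta i) :: rat vec)" for i
    by (intro eq_vecI) (auto simp: unit_vec_def)
  define y where "y i = (if i = b then (\<lambda>j. delta b j - rat_of_int k * delta a j) else delta i)" for i
  have refl: "reflection ?M (unit_vec n a) (unit_vec n b) = vec n (y b)"
  proof -
    have "2 * form ?M (unit_vec n a) (unit_vec n b) / form ?M (unit_vec n a) (unit_vec n a) = rat_of_int k"
      using a b d_pos[OF a] nrm[OF adm a] by (simp add: unit form_mat_vec ip_delta k)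
    then show ?thesis unfolding reflection_def
      by (intro eq_vecI) (auto simp: y_def unit_vec_def)
  qed
  have basis: "braid_basis ?M a b (unit_vec n) i = vec n (y i)" for i
    unfolding braid_basis_def using refl by (auto simp: unit y_def)
  have y: "ip n ?G (y i) (y j) = rat_of_int (pair (move a b \<beta> i) (move a b \<beta> j))"
    if "i < n" "j < n" for i j
    using that a b by (simp add: y_def mv ip_diff_left ip_diff_right ip_delta)
  have "tuple_mat (move a b \<beta>) = structural_mat n ?M (braid_basis ?M a b (unit_vec n))"
    unfolding structural_mat_def basis form_mat_vec tuple_mat_def
    using y nrm[OF admissible_move[OF adm a b]]
    by (intro eq_matI) auto
  then show ?thesis
    unfolding braid_step_def using symmetrizer_tuple_mat[OF gcd, of \<beta>] a b
    by (metis symmetrized_tuple_mat)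
qed

lemma reachable_braid_steps:
  assumes gcd: "Gcd (d ` {..<n}) = 1" and "reachable \<beta>"
  shows "(braid_step n)\<^sup>*\<^sup>* (tuple_mat delta) (tuple_mat \<beta>)"
  using assms(2)
proof induction
  case (move \<beta> a b)
  then show ?case
    using braid_step_move[OF gcd reachable_admissible] by (meson rtranclp.rtrancl_into_rtrancl)
qed simp

text \<open>The matrix maps a lattice vector \<open>x\<close> to its products with the basis, divided by \<open>d\<close>. The images of
  the chosen roots are independent because their Gram matrix is definite. They span the column
  space because the tuple generates the lattice and the image does not see the radical,
  so that every root has the same image as a multiple of a chosen one.\<close>

lemma rank_eq_card_subsystem:
  assumes adm: "admissible \<beta>" and J: "J = p ` {..<r}" "inj_on p {..<r}" "J \<subseteq> {..<n}"
    and \<rho>: "\<And>i. i < n \<Longrightarrow> \<rho> i \<in> J"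
    and c: "\<And>i z. i < n \<Longrightarrow> pair z (\<beta> i) = c i * pair z (\<beta> (\<rho> i))"
    and indep: "\<And>x :: nat \<Rightarrow> real. (\<Sum>i\<in>J. \<Sum>j\<in>J. x i * real_of_int (pair (\<beta> i) (\<beta> j)) * x j) = 0 \<Longrightarrow>
           \<forall>i\<in>J. x i = 0"
  shows "vec_space.rank n (tuple_mat delta) = r"
proof -
  interpret vec_space "TYPE(rat)" n .
  define col_of where "col_of x = vec n (\<lambda>i. rat_of_int (pair (delta i) x) / of_nat (d i))" for x
  define N where "N = mat n r (\<lambda>(i, k). col_of (\<beta> (p k)) $ i)"
  let ?A = "tuple_mat delta"
  have N: "N \<in> carrier_mat n r" by (simp add: N_def)
  have A: "?A \<in> carrier_mat n n" by (simp add: tuple_mat_def)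
  have p: "p k < n" if "k < r" for k using J that by auto
  have colN: "col N k = col_of (\<beta> (p k))" if "k < r" for k
    unfolding N_def using that by (intro eq_vecI) (auto simp: col_of_def)
  have colA: "col ?A i = col_of (delta i)" if "i < n" for i
    unfolding tuple_mat_def col_of_def using that by (intro eq_vecI) auto
  have carr: "set (cols N) \<subseteq> carrier_vec n" using N cols_dim by blast
  have A_entries: "?A = mat n n (\<lambda>(i, j). rat_of_int (B i j) / of_nat (d i))"
    unfolding tuple_mat_def by (intro eq_matI) (auto simp: ip_delta)
  have A_col_of: "?A *\<^sub>v vec n (\<lambda>k. rat_of_int (x k)) = col_of x" for x
    unfolding A_entries col_of_def
    by (intro eq_vecI)
      (auto simp: scalar_prod_def ip_delta_left sum_divide_distrib lessThan_atLeast0 intro!: sum.cong)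
  show ?thesis
  proof (rule rank_eqI[OF A N])
    fix v :: "rat vec"
    assume v: "v \<in> carrier_vec r" and 0: "N *\<^sub>v v = 0\<^sub>v n"
    have row: "(\<Sum>k<r. v $ k * rat_of_int (pair (delta i) (\<beta> (p k)))) = 0" if i: "i < n" for i
    proof -
      have "(N *\<^sub>v v) $ i = (\<Sum>k<r. v $ k * rat_of_int (pair (delta i) (\<beta> (p k)))) / of_nat (d i)"
        using i v by (simp add: N_def col_of_def scalar_prod_def sum_divide_distrib lessThan_atLeast0 ac_simps)
      then show ?thesis using 0 i d_pos[OF i] by simp
    qed
    have expand: "rat_of_int (pair z y) = (\<Sum>i<n. rat_of_int (z i) * rat_of_int (pair (delta i) y))" for z y
    proof -
      have "pair z y = (\<Sum>i<n. z i * pair (delta i) y)"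
        by (simp add: ip_delta_left) (simp add: ip_def sum_distrib_left mult.assoc)
      then show ?thesis by simp
    qed
    have all: "(\<Sum>k<r. v $ k * rat_of_int (pair z (\<beta> (p k)))) = 0" for z
    proof -
      have "(\<Sum>k<r. v $ k * rat_of_int (pair z (\<beta> (p k)))) =
        (\<Sum>k<r. \<Sum>i<n. rat_of_int (z i) * (v $ k * rat_of_int (pair (delta i) (\<beta> (p k)))))"
        by (subst expand) (simp add: sum_distrib_left ac_simps)
      also have "\<dots> = (\<Sum>i<n. rat_of_int (z i) * (\<Sum>k<r. v $ k * rat_of_int (pair (delta i) (\<beta> (p k)))))"
        by (subst sum.swap) (simp add: sum_distrib_left)
      also have "\<dots> = 0" using row by simp
      finally show ?thesis .
    qed
    define x where "x j = real_of_rat (v $ the_inv_into {..<r} p j)" for j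
    have x: "x (p k) = real_of_rat (v $ k)" if "k < r" for k
      using that J(2) by (simp add: x_def the_inv_into_f_f)
    have "(\<Sum>j\<in>J. real_of_int (pair z (\<beta> j)) * x j) = 0" for z
    proof -
      have "(\<Sum>j\<in>J. real_of_int (pair z (\<beta> j)) * x j) = (\<Sum>k<r. real_of_int (pair z (\<beta> (p k))) * x (p k))"
        unfolding J(1) by (rule sum.reindex[OF J(2), unfolded o_def])
      also have "\<dots> = real_of_rat (\<Sum>k<r. v $ k * rat_of_int (pair z (\<beta> (p k))))"
        by (simp add: x of_rat_sum of_rat_mult ac_simps)
      finally show ?thesis by (simp add: all)
    qed
    then have "(\<Sum>i\<in>J. \<Sum>j\<in>J. x i * real_of_int (pair (\<beta> i) (\<beta> j)) * x j) = 0"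
      by (simp add: mult.assoc flip: sum_distrib_left)
    from indep[OF this] show "v = 0\<^sub>v r"
      using v x J(1) by (intro eq_vecI) auto
  next
    fix k assume k: "k < r"
    show "col N k \<in> span (set (cols ?A))"
      unfolding colN[OF k] A_col_of[symmetric] by (rule mat_vec_in_span_cols[OF A]) simp
  next
    fix i assume i: "i < n"
    \<comment> \<open>The lattice vectors with col_of in the span form a subgroup that contains the tuple.\<close>
    define S where "S = {x. col_of x \<in> span (set (cols N))}"
    have "(\<lambda>j. x j - k * y j) \<in> S" if x: "x \<in> S" and y: "y \<in> S" for x y k
    proof -
      have e: "col_of (\<lambda>j. x j - k * y j) = col_of x + rat_of_int (- k) \<cdot>\<^sub>v col_of y"
        unfolding col_of_def by (intro eq_vecI) (auto simp: ip_diff_right diff_divide_distrib)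
      have "rat_of_int (- k) \<cdot>\<^sub>v col_of y \<in> span (set (cols N))"
        by (rule smult_in_span[OF carr]) (use y in \<open>simp add: S_def\<close>)
      then have "col_of x + rat_of_int (- k) \<cdot>\<^sub>v col_of y \<in> span (set (cols N))"
        using x span_add1[OF carr] by (simp add: S_def)
      then show ?thesis by (simp only: S_def e mem_Collect_eq)
    qed
    moreover have "\<beta> i \<in> S" if i: "i < n" for i
    proof -
      obtain k where k: "k < r" "\<rho> i = p k" using \<rho>[OF i] J(1) by auto
      have e: "col_of (\<beta> i) = rat_of_int (c i) \<cdot>\<^sub>v col N k"
        unfolding colN[OF k(1)] k(2)[symmetric] col_of_def using c[OF i] by (intro eq_vecI) auto
      have "col N k \<in> set (cols N)" using k(1) N by (auto simp: cols_def)
      then have "col N k \<in> span (set (cols N))" using in_own_span[OF carr] by blast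
      then have "rat_of_int (c i) \<cdot>\<^sub>v col N k \<in> span (set (cols N))" by (rule smult_in_span[OF carr])
      then show ?thesis by (simp only: S_def e mem_Collect_eq)
    qed
    ultimately have "delta i \<in> S" by (rule admissible_generates[OF adm i])
    then show "col ?A i \<in> span (set (cols N))" unfolding colA[OF i] by (simp add: S_def)
  qed
qed

section \<open>Cartan matrix and affinization\<close>

text \<open>For \<open>r = n\<close> this is the structural matrix with permuted indices; for smaller \<open>r\<close> and a permutation that
  puts the simple roots first, it is their Cartan matrix.\<close>

definition subtuple_mat :: "(nat \<Rightarrow> nat \<Rightarrow> int) \<Rightarrow> (nat \<Rightarrow> nat) \<Rightarrow> nat \<Rightarrow> rat mat" where
  "subtuple_mat \<beta> p r = mat r r (\<lambda>(i, j). of_int (pair (\<beta> (p i)) (\<beta> (p j))) / of_nat (d (p i)))"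

lemma symmetrized_subtuple_mat:
  assumes "p ` {..<r} \<subseteq> {..<n}"
  shows "symmetrized r (d \<circ> p) (subtuple_mat \<beta> p r) =
    mat r r (\<lambda>(i, j). of_int (pair (\<beta> (p i)) (\<beta> (p j))))"
proof -
  have nz: "d (p i) \<noteq> 0" if "i < r" for i using d_pos[of "p i"] assms that by force
  show ?thesis unfolding subtuple_mat_def symmetrized_mat by (intro eq_matI) (auto simp: nz)
qed

lemma symmetrizer_subtuple_mat:
  assumes p: "p ` {..<r} \<subseteq> {..<n}" and gcd: "Gcd (d ` p ` {..<r}) = 1"
  shows "symmetrizer r (d \<circ> p) (subtuple_mat \<beta> p r)"
proof -
  have "d (p i) > 0" if "i < r" for i using d_pos[of "p i"] p that by force
  then show ?thesis
    unfolding symmetrizer_def symmetrized_subtuple_mat[OF p]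
    using gcd by (auto intro!: eq_matI simp: pair_commute image_comp)
qed

lemma gen_intersection_subtuple_mat:
  assumes adm: "admissible \<beta>" and p: "p ` {..<r} \<subseteq> {..<n}"
  shows "gen_intersection_matrix r (subtuple_mat \<beta> p r)"
proof -
  have pn: "p i < n" if "i < r" for i using p that by force
  have dp: "d (p i) > 0" if "i < r" for i using d_pos pn that by blast
  have "rat_of_int (pair (\<beta> (p i)) (\<beta> (p j))) / of_nat (d (p i)) \<in> \<int>" if "i < r" "j < r" for i j
  proof -
    have "int (d (p i)) dvd pair (\<beta> (p i)) (\<beta> (p j))"
      using adm pn that by (simp add: admissible_def)
    then obtain k where "pair (\<beta> (p i)) (\<beta> (p j)) = int (d (p i)) * k" by (auto elim: dvdE)
    then show ?thesis using dp[OF that(1)] by simp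
  qed
  moreover have "pair (\<beta> (p i)) (\<beta> (p i)) = 2 * int (d (p i))" if "i < r" for i
    using adm pn that by (simp add: admissible_def)
  moreover have "pair (\<beta> (p i)) (\<beta> (p j)) = pair (\<beta> (p j)) (\<beta> (p i))" for i j
    by (rule pair_commute)
  ultimately show ?thesis
    unfolding gen_intersection_matrix_def subtuple_mat_def using dp
    by (auto simp: divide_less_0_iff zero_less_divide_iff dest: dp)
qed

text \<open>A real vector is a combination of the chosen roots, whose norm is non-negative; independence
  excludes the value zero.\<close>

lemma cartan_subtuple_mat:
  assumes adm: "admissible \<beta>" and p: "p ` {..<r} \<subseteq> {..<n}" and inj: "inj_on p {..<r}"
    and gcd: "Gcd (d ` p ` {..<r}) = 1"
    and obtuse: "\<And>i j. i \<in> p ` {..<r} \<Longrightarrow> j \<in> p ` {..<r} \<Longrightarrow> i \<noteq> j \<Longrightarrow> pair (\<beta> i) (\<beta> j) \<le> 0"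
    and indep: "\<And>x :: nat \<Rightarrow> real.
      (\<Sum>i\<in>p ` {..<r}. \<Sum>j\<in>p ` {..<r}. x i * real_of_int (pair (\<beta> i) (\<beta> j)) * x j) = 0 \<Longrightarrow>
           \<forall>i\<in>p ` {..<r}. x i = 0"
  shows "cartan_matrix r (subtuple_mat \<beta> p r)"
proof -
  let ?C = "subtuple_mat \<beta> p r"
  have sym: "symmetrizer r (d \<circ> p) ?C" by (rule symmetrizer_subtuple_mat[OF p gcd])
  have gen: "gen_intersection_matrix r ?C" by (rule gen_intersection_subtuple_mat[OF adm p])
  have dp: "d (p i) > 0" if "i < r" for i using d_pos[of "p i"] p that by force
  have "?C $$ (i, j) \<le> 0" if ij: "i < r" "j < r" "i \<noteq> j" for i j
  proof -
    have "p i \<noteq> p j" using inj ij by (auto simp: inj_on_def)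
    then show ?thesis using obtuse[of "p i" "p j"] ij dp[OF ij(1)]
      by (simp add: subtuple_mat_def divide_le_0_iff)
  qed
  moreover have "?C $$ (i, j) = 0 \<longleftrightarrow> ?C $$ (j, i) = 0" if "i < r" "j < r" for i j
    using dp that pair_commute[of "\<beta> (p i)" "\<beta> (p j)"] by (auto simp: subtuple_mat_def dest: dp)
  moreover have "?C \<in> carrier_mat r r" "\<And>i j. i < r \<Longrightarrow> j < r \<Longrightarrow> ?C $$ (i, j) \<in> \<int>"
      "\<And>i. i < r \<Longrightarrow> ?C $$ (i, i) = 2"
    using gen unfolding gen_intersection_matrix_def by simp_all
  ultimately have cartan: "gen_cartan_matrix r ?C"
    unfolding gen_cartan_matrix_def by (intro conjI allI impI)
  let ?G = "\<lambda>i j. real_of_int (pair (\<beta> (p i)) (\<beta> (p j)))"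
  have real_G: "map_mat real_of_rat (symmetrized r (d \<circ> p) ?C) = mat r r (\<lambda>(i, j). ?G i j)"
    unfolding symmetrized_subtuple_mat[OF p] by (intro eq_matI) auto
  have "0 < v \<bullet> (map_mat real_of_rat (symmetrized r (d \<circ> p) ?C) *\<^sub>v v)"
    if v: "v \<in> carrier_vec r" and v0: "v \<noteq> 0\<^sub>v r" for v :: "real vec"
  proof -
    have vec_v: "vec r (($) v) = v" using v by auto
    define u where "u k = (\<Sum>i<r. v $ i * real_of_int (\<beta> (p i) k))" for k
    have val: "v \<bullet> (map_mat real_of_rat (symmetrized r (d \<circ> p) ?C) *\<^sub>v v) = ip r ?G (($) v) (($) v)"
      unfolding real_G by (rule mat_vec_ip[of r "($) v" ?G "($) v", unfolded vec_v])
    also have u: "\<dots> = ip n (\<lambda>i j. real_of_int (B i j)) u u"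
      unfolding u_def ip_sum_left ip_sum_right ip_of_int
      by (simp add: ip_def[of r] sum_distrib_left ac_simps)
    finally have "0 \<le> v \<bullet> (map_mat real_of_rat (symmetrized r (d \<circ> p) ?C) *\<^sub>v v)"
      using psd_real by simp
    moreover have "ip r ?G (($) v) (($) v) \<noteq> 0"
    proof
      assume 0: "ip r ?G (($) v) (($) v) = 0"
      define x where "x j = v $ the_inv_into {..<r} p j" for j
      have x: "x (p k) = v $ k" if "k < r" for k
        using that inj by (simp add: x_def the_inv_into_f_f)
      have "(\<Sum>i\<in>p ` {..<r}. \<Sum>j\<in>p ` {..<r}. x i * real_of_int (pair (\<beta> i) (\<beta> j)) * x j) =
        ip r ?G (($) v) (($) v)"
        unfolding ip_def sum.reindex[OF inj] o_def using x by (auto intro!: sum.cong)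
      with 0 have "\<forall>i\<in>p ` {..<r}. x i = 0" by (intro indep) simp
      then have "v = 0\<^sub>v r" using x v by (intro eq_vecI) auto
      with v0 show False by simp
    qed
    ultimately show ?thesis using val by simp
  qed
  with sym have "pos_def r ?C" unfolding pos_def_def by blast
  with cartan sym show ?thesis unfolding cartan_matrix_def by blast
qed

text \<open>In the space with basis the simple roots, \<open>\<beta> (p i)\<close> is represented by \<open>c (p i)\<close> times the simple root
  of its class, which has the same products with all the others. As \<open>c\<close> takes the values 1 and 2, this is a
  root or twice a root.\<close>

lemma affinization_subtuple_mat:
  assumes adm: "admissible \<beta>" and p: "p permutes {..<n}" and n: "n = r + k"
    and gcd: "Gcd (d ` p ` {..<r}) = 1"
    and \<rho>: "\<And>i. i < n \<Longrightarrow> \<rho> i \<in> p ` {..<r}"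
    and self: "\<And>i. i \<in> p ` {..<r} \<Longrightarrow> \<rho> i = i \<and> c i = 1"
    and c12: "\<And>i. i < n \<Longrightarrow> c i = 1 \<or> c i = 2"
    and c: "\<And>i z. i < n \<Longrightarrow> pair z (\<beta> i) = c i * pair z (\<beta> (\<rho> i))"
  shows "affinization r k (subtuple_mat \<beta> p r) (subtuple_mat \<beta> p n)"
proof -
  have pr: "p ` {..<r} \<subseteq> {..<n}" using permutes_image[OF p] n by auto
  have pn: "p i < n" if "i < n" for i using permutes_in_image[OF p, of i] that by simp
  define q where "q i = inv_into UNIV p (\<rho> (p i))" for i
  have q: "q i < r" "p (q i) = \<rho> (p i)" if i: "i < n" for i
  proof -
    obtain s where "s < r" "\<rho> (p i) = p s" using \<rho>[OF pn[OF i]] by auto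
    then show "q i < r" "p (q i) = \<rho> (p i)"
      using permutes_inverses[OF p] by (simp_all add: q_def)
  qed
  define x where "x i = (\<lambda>j. rat_of_int (c (p i)) * delta (q i) j)" for i
  define \<alpha> where "\<alpha> i = vec r (x i)" for i
  let ?G = "\<lambda>i j. rat_of_int (pair (\<beta> (p i)) (\<beta> (p j)))"
  have \<alpha>: "\<alpha> i = rat_of_int (c (p i)) \<cdot>\<^sub>v unit_vec r (q i)" for i
    unfolding \<alpha>_def x_def by (intro eq_vecI) (auto simp: unit_vec_def)
  have sym: "symmetrizer r (d \<circ> p) (subtuple_mat \<beta> p r)"
    by (rule symmetrizer_subtuple_mat[OF pr gcd])
  have form: "ip r ?G (x i) (x j) = ?G i j" if i: "i < n" and j: "j < n" for i j
  proof -
    have "ip r ?G (x i) (x j) = rat_of_int (c (p i)) * rat_of_int (c (p j)) * ip r ?G (delta (q i)) (delta (q j))"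
      unfolding x_def ip_def by (simp add: sum_distrib_left ac_simps)
    also have "\<dots> = rat_of_int (c (p i) * (c (p j) * pair (\<beta> (\<rho> (p i))) (\<beta> (\<rho> (p j)))))"
      using q[OF i] q[OF j] by (simp add: ip_delta)
    also have "c (p j) * pair (\<beta> (\<rho> (p i))) (\<beta> (\<rho> (p j))) = pair (\<beta> (p j)) (\<beta> (\<rho> (p i)))"
      using c[OF pn[OF j], of "\<beta> (\<rho> (p i))"] by (simp add: pair_commute)
    also have "c (p i) * pair (\<beta> (p j)) (\<beta> (\<rho> (p i))) = pair (\<beta> (p i)) (\<beta> (p j))"
      using c[OF pn[OF i], of "\<beta> (p j)"] by (simp add: pair_commute)
    finally show ?thesis .
  qed
  have "\<alpha> i = unit_vec r i" if i: "i < r" for i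
  proof -
    have "q i = i" "c (p i) = 1"
      using self[of "p i"] i permutes_inverses[OF p] by (simp_all add: q_def)
    then show ?thesis by (simp add: \<alpha>)
  qed
  moreover have "\<alpha> i \<in> root_system r D \<union> (\<lambda>\<beta>. 2 \<cdot>\<^sub>v \<beta>) ` root_system r D" if i: "i < n" for i D
  proof -
    have "unit_vec r (q i) \<in> root_system r D" by (rule root_system.simple[OF q(1)[OF i]])
    then show ?thesis using c12[OF pn[OF i]] by (auto simp: \<alpha>)
  qed
  moreover have "subtuple_mat \<beta> p n = structural_mat (r + k) (symmetrized r (d \<circ> p) (subtuple_mat \<beta> p r)) \<alpha>"
  proof -
    have "pair (\<beta> (p i)) (\<beta> (p i)) = 2 * int (d (p i))" if "i < n" for i
      using adm pn[OF that] by (simp add: admissible_def)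
    then show ?thesis
      unfolding structural_mat_def symmetrized_subtuple_mat[OF pr] \<alpha>_def form_mat_vec
        subtuple_mat_def[of _ _ n] n[symmetric]
      using form by (intro eq_matI) auto
  qed
  moreover have "gen_intersection_matrix n (subtuple_mat \<beta> p n)"
    by (rule gen_intersection_subtuple_mat[OF adm]) (simp add: permutes_image[OF p])
  ultimately show ?thesis
    unfolding affinization_def using sym n
    by (intro exI[of _ "d \<circ> p"] exI[of _ \<alpha>]) (auto simp: gen_intersection_matrix_def)
qed

text \<open>The symmetrizer of the Cartan matrix is \<open>d\<close> restricted to the simple roots; it is still primitive,
  since \<open>d\<^sub>i = c\<^sub>i\<^sup>2 d\<^sub>\<rho>\<^sub>i\<close> for all \<open>i\<close>.\<close>

lemma braid_equivalent_affinization: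
  assumes gcd: "Gcd (d ` {..<n}) = 1"
  obtains C X r where "r \<le> n" and "vec_space.rank n (tuple_mat delta) = r"
    and "cartan_matrix r C" and "affinization r (n - r) C X" and "SIM n X"
    and "(\<lambda>X Y. braid_step n X Y \<or> perm_step n X Y)\<^sup>*\<^sup>* (tuple_mat delta) X"
proof -
  obtain \<beta> J \<rho> c where r: "reachable \<beta>" and J: "J \<subseteq> {..<n}"
    and \<rho>: "\<And>i. i < n \<Longrightarrow> \<rho> i \<in> J" and self: "\<And>i. i \<in> J \<Longrightarrow> \<rho> i = i \<and> c i = 1"
    and c12: "\<And>i. i < n \<Longrightarrow> c i = 1 \<or> c i = 2"
    and c: "\<And>i z. i < n \<Longrightarrow> pair z (\<beta> i) = c i * pair z (\<beta> (\<rho> i))"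
    and obtuse: "\<And>i j. i \<in> J \<Longrightarrow> j \<in> J \<Longrightarrow> i \<noteq> j \<Longrightarrow> pair (\<beta> i) (\<beta> j) \<le> 0"
    and indep: "\<And>x :: nat \<Rightarrow> real. (\<Sum>i\<in>J. \<Sum>j\<in>J. x i * real_of_int (pair (\<beta> i) (\<beta> j)) * x j) = 0 \<Longrightarrow>
           \<forall>i\<in>J. x i = 0"
    using reachable_simple_subsystem by blast
  have adm: "admissible \<beta>" by (rule reachable_admissible[OF r])
  obtain p where p: "p permutes {..<n}" and pJ: "p ` {..<card J} = J"
    using ex_permutes_image[OF J] .
  have cJ: "card J \<le> n" using card_mono[OF _ J] by simp
  have inj: "inj_on p {..<card J}" using permutes_inj_on[OF p] .
  have "Gcd (d ` J) dvd d i" if i: "i < n" for i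
  proof -
    have "2 * int (d i) = pair (\<beta> i) (\<beta> i)" using adm i by (simp add: admissible_def)
    also have "\<dots> = c i * pair (\<beta> (\<rho> i)) (\<beta> i)"
      using c[OF i, of "\<beta> i"] by (simp add: pair_commute)
    also have "pair (\<beta> (\<rho> i)) (\<beta> i) = c i * (2 * int (d (\<rho> i)))"
      using c[OF i, of "\<beta> (\<rho> i)"] adm \<rho>[OF i] J by (auto simp: admissible_def)
    finally have "int (d i) = c i * c i * int (d (\<rho> i))" by simp
    then have "int (d (\<rho> i)) dvd int (d i)" by simp
    then have "d (\<rho> i) dvd d i" by simp
    moreover have "Gcd (d ` J) dvd d (\<rho> i)" using \<rho>[OF i] by simp
    ultimately show ?thesis by (rule dvd_trans[rotated])
  qed
  then have "Gcd (d ` J) dvd Gcd (d ` {..<n})" by (intro Gcd_greatest) auto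
  then have gJ: "Gcd (d ` p ` {..<card J}) = 1" using gcd by (simp add: pJ)
  have pn: "p ` {..<n} = {..<n}" by (rule permutes_image[OF p])
  let ?X = "subtuple_mat \<beta> p n"
  show thesis
  proof (rule that[OF cJ])
    show "vec_space.rank n (tuple_mat delta) = card J"
      by (rule rank_eq_card_subsystem[OF adm pJ[symmetric] inj J \<rho> c indep])
    show "cartan_matrix (card J) (subtuple_mat \<beta> p (card J))"
      by (rule cartan_subtuple_mat[OF adm _ inj gJ, unfolded pJ, OF J obtuse indep])
    show "affinization (card J) (n - card J) (subtuple_mat \<beta> p (card J)) ?X"
      by (rule affinization_subtuple_mat[OF adm p _ gJ, unfolded pJ, OF _ \<rho> self c12 c])
        (use cJ in simp)
    show "SIM n ?X"
      unfolding SIM_def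
      using gen_intersection_subtuple_mat[OF adm, of p n] symmetrizer_subtuple_mat[of p n \<beta>] gcd pn
      by auto
    have "perm_step n (tuple_mat \<beta>) ?X"
    proof -
      have "p i < n" if "i < n" for i using pn that by blast
      then have "?X = mat n n (\<lambda>(i, j). tuple_mat \<beta> $$ (p i, p j))"
        unfolding subtuple_mat_def tuple_mat_def by (intro eq_matI) auto
      then show ?thesis using p unfolding perm_step_def by blast
    qed
    moreover have "(\<lambda>X Y. braid_step n X Y \<or> perm_step n X Y)\<^sup>*\<^sup>* (tuple_mat delta) (tuple_mat \<beta>)"
      using reachable_braid_steps[OF gcd r] by (rule rtranclp_mono[THEN predicate2D, rotated]) blast
    ultimately show "(\<lambda>X Y. braid_step n X Y \<or> perm_step n X Y)\<^sup>*\<^sup>* (tuple_mat delta) ?X"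
      using rtranclp.rtrancl_into_rtrancl[of "\<lambda>X Y. braid_step n X Y \<or> perm_step n X Y"] by blast
  qed
qed

end

theorem theorem3p11:
  fixes l d :: nat and A :: "rat mat"
  assumes "SIM (l + d) A"
    and "pos_semidef (l + d) A"
    and "vec_space.rank (l + d) A = l"
  shows "\<exists>C X. cartan_matrix l C \<and> affinization l d C X \<and> braid_equivalent (l + d) A X"
proof -
  define n where "n = l + d"
  obtain e where sym: "symmetrizer n e A"
    and psd: "\<And>v. v \<in> carrier_vec n \<Longrightarrow> 0 \<le> v \<bullet> (map_mat real_of_rat (symmetrized n e A) *\<^sub>v v)"
    using assms(2) unfolding pos_semidef_def n_def by blast
  have A: "A \<in> carrier_mat n n" and A_int: "\<And>i j. i < n \<Longrightarrow> j < n \<Longrightarrow> A $$ (i, j) \<in> \<int>"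
    and A_diag: "\<And>i. i < n \<Longrightarrow> A $$ (i, i) = 2"
    using assms(1) unfolding SIM_def gen_intersection_matrix_def n_def by auto
  have e_pos: "0 < e i" if "i < n" for i using sym that unfolding symmetrizer_def by blast
  have gcd: "Gcd (e ` {..<n}) = 1" using sym unfolding symmetrizer_def by blast
  have DA: "symmetrized n e A = mat n n (\<lambda>(i, j). of_nat (e i) * A $$ (i, j))"
    unfolding symmetrized_def by (rule mat_diag_mult_left[OF A])
  define B where "B i j = int (e i) * \<lfloor>A $$ (i, j)\<rfloor>" for i j
  have B: "rat_of_int (B i j) = of_nat (e i) * A $$ (i, j)" if "i < n" "j < n" for i j
    using A_int[OF that] by (auto simp: B_def elim: Ints_cases)
  have DB: "symmetrized n e A = mat n n (\<lambda>(i, j). rat_of_int (B i j))"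
    unfolding DA using B by (intro eq_matI) auto
  interpret sim_lattice n B e
  proof
    show "B i j = B j i" if "i < n" "j < n" for i j
    proof -
      have "transpose_mat (symmetrized n e A) $$ (i, j) = symmetrized n e A $$ (i, j)"
        using sym unfolding symmetrizer_def by simp
      then show ?thesis using that by (simp add: DB)
    qed
    show "B i i = 2 * int (e i)" if "i < n" for i using A_diag[OF that] by (simp add: B_def)
    show "0 < e i" if "i < n" for i by (rule e_pos[OF that])
    show "int (e i) dvd B i j" for i j by (simp add: B_def)
    fix x :: "nat \<Rightarrow> real"
    have "map_mat real_of_rat (symmetrized n e A) = mat n n (\<lambda>(i, j). real_of_int (B i j))"
      unfolding DB by (intro eq_matI) auto
    then show "0 \<le> ip n (\<lambda>i j. real_of_int (B i j)) x x"
      using psd[of "vec n x"] by (simp add: mat_vec_ip)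
  qed
  have A_tuple: "tuple_mat delta = A"
    unfolding tuple_mat_def using A e_pos by (intro eq_matI) (auto simp: ip_delta B dest: e_pos)
  obtain C X r where rn: "r \<le> n" and rank: "vec_space.rank n (tuple_mat delta) = r"
    and CX: "cartan_matrix r C" "affinization r (n - r) C X" "SIM n X"
      "(\<lambda>X Y. braid_step n X Y \<or> perm_step n X Y)\<^sup>*\<^sup>* (tuple_mat delta) X"
    using braid_equivalent_affinization[OF gcd] by blast
  have "r = l" using rank[unfolded A_tuple] assms(3) by (simp add: n_def)
  moreover have "n - r = d" using \<open>r = l\<close> by (simp add: n_def)
  moreover have "braid_equivalent (l + d) A X"
    using CX(3) CX(4)[unfolded A_tuple] assms(1) unfolding braid_equivalent_def n_def by blast
  ultimately show ?thesis using CX(1,2) by auto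
qed

end
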